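(* For $0<p<1$, $q=1-p$ and an integer $m\ge 1$, let $$f_k=\binom{m+k-1}{k}\left(p^m q^k+q^m p^k\right),\qquad k=0,\dots,m-1,$$ be the probability mass function of the riff-shuffle distribution with parameters $m$ and $p$. Then: (i) if $p=\tfrac12$, then for every integer $m\ge 1$ the sequence $(f_k)_{k=0}^{m-1}$ is log-concave; (ii) for every $p\in(0,1)$ with $p\neq\tfrac12$ there exists an integer $m_0$ (depending on $p$) such that for all integers $m\ge m_0$ the sequence $(f_k)_{k=0}^{m-1}$ is not log-concave.
   Context: A finite real sequence $(g_k)_{k=0}^n$ is called log-concave if $g_k^2\ge g_{k-1}g_{k+1}$ holds for all integers $k$ with $1\le k<n$. In particular, for the sequence $(f_k)_{k=0}^{m-1}$ one has $n=m-1$, and the values of $f_k$ are only considered for $0\le k\le m-1$. *)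

theory Defs
  imports Complex_Main
begin

(* A finite real sequence g 0, ..., g n is a function on nat together with its last index n;
   values of g beyond n are never inspected. *)
definition log_concave :: "nat \<Rightarrow> (nat \<Rightarrow> real) \<Rightarrow> bool" where
  "log_concave n g \<longleftrightarrow> (\<forall>k. 1 \<le> k \<and> k < n \<longrightarrow> (g k)\<^sup>2 \<ge> g (k - 1) * g (k + 1))"

(* Meaningful for m \<ge> 1 and k \<le> m - 1. With m \<ge> 1 the truncated subtraction on nat is harmless. *)
definition riff_shuffle_pmf :: "nat \<Rightarrow> real \<Rightarrow> nat \<Rightarrow> real" where
  "riff_shuffle_pmf m p k =
     real ((m + k - 1) choose k) * (p ^ m * (1 - p) ^ k + (1 - p) ^ m * p ^ k)"

end

theory Submission
  imports Defs
begin

text \<open>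
  Write \<open>f\<^sub>k = c\<^sub>k h\<^sub>k\<close> with \<open>c\<^sub>k\<close> the binomial coefficient and \<open>h\<^sub>k = p\<^sup>m q\<^sup>k + q\<^sup>m p\<^sup>k\<close>.
  The ratio \<open>c\<^sub>k\<^sup>2 / (c\<^sub>k\<^sub>-\<^sub>1 c\<^sub>k\<^sub>+\<^sub>1)\<close> equals \<open>1 + (m - 1) / (k (m + k)) \<ge> 1\<close>, whereas
  \<open>h\<^sub>k\<^sub>-\<^sub>1 h\<^sub>k\<^sub>+\<^sub>1 - h\<^sub>k\<^sup>2 = (pq)\<^sup>m\<^sup>+\<^sup>k\<^sup>-\<^sup>1 (p - q)\<^sup>2\<close>, which vanishes for \<open>p = q\<close>.  For \<open>p \<noteq> q\<close> take
  \<open>k = m - 2\<close>: the first excess is \<open>1 / (2 (m - 2)) \<longrightarrow> 0\<close>, but \<open>h\<^sub>k\<^sub>-\<^sub>1 h\<^sub>k\<^sub>+\<^sub>1 / h\<^sub>k\<^sup>2\<close> exceeds \<open>1\<close> by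
  the constant \<open>p q (p - q)\<^sup>2 / (p\<^sup>2 + q\<^sup>2)\<^sup>2 > 0\<close>.
\<close>

definition riff_weight :: "nat \<Rightarrow> real \<Rightarrow> nat \<Rightarrow> real" where
  "riff_weight m p k = p ^ m * (1 - p) ^ k + (1 - p) ^ m * p ^ k"

text \<open>With \<open>q = 1 - p\<close>, the diagonal terms of both sides agree; the cross terms
  are \<open>(p * q) ^ (m + j)\<close> times \<open>p\<^sup>2 + q\<^sup>2\<close> on the left and
  \<open>2 * p * q\<close> on the right, and \<open>p - q = 2 * p - 1\<close>.\<close>

lemma riff_weight_mult_eq:
  "riff_weight m p j * riff_weight m p (j + 2) =
     (riff_weight m p (j + 1))\<^sup>2 + (p * (1 - p)) ^ (m + j) * (2 * p - 1)\<^sup>2"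
  unfolding riff_weight_def
  by (simp add: power_add power_mult_distrib) algebra

text \<open>Two consecutive absorption identities, cross-multiplied to avoid division.\<close>

lemma binomial_pair_eq:
  "real ((a + j) choose j) * real ((a + (j + 2)) choose (j + 2)) * (real (a + j + 1) * real (j + 2)) =
     (real ((a + (j + 1)) choose (j + 1)))\<^sup>2 * (real (j + 1) * real (a + j + 2))"
proof -
  have step: "real (i + 1) * real ((a + (i + 1)) choose (i + 1)) =
      real (a + i + 1) * real ((a + i) choose i)" for i
    using Suc_times_binomial_eq[of "a + i" i]
    by (simp only: of_nat_mult[symmetric] add_Suc_right Suc_eq_plus1[symmetric] mult.commute)
  show ?thesis
    using step[of j] step[of "j + 1"]
    by (simp only: power2_eq_square add.assoc one_add_one) algebra
qed

text \<open>Eliminates the binomials, so that both claims reduce to the weights. Setting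
  \<open>m = a + 1\<close> and \<open>k = j + 1\<close> avoids truncated subtraction.\<close>

lemma riff_shuffle_pmf_mult_le_iff:
  fixes p :: real and a j :: nat
  defines "h \<equiv> riff_weight (a + 1) p"
  shows "riff_shuffle_pmf (a + 1) p j * riff_shuffle_pmf (a + 1) p (j + 2)
       \<le> (riff_shuffle_pmf (a + 1) p (j + 1))\<^sup>2 \<longleftrightarrow>
     real (j + 1) * real (a + j + 2) * (h j * h (j + 2))
       \<le> real (a + j + 1) * real (j + 2) * (h (j + 1))\<^sup>2"
proof -
  define c where "c k = real ((a + k) choose k)" for k
  define A where "A = real (a + j + 1) * real (j + 2)"
  define B where "B = real (j + 1) * real (a + j + 2)"
  have f: "riff_shuffle_pmf (a + 1) p k = c k * h k" for k
    by (simp add: riff_shuffle_pmf_def riff_weight_def c_def h_def)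
  have A: "A > 0" by (simp add: A_def)
  have c: "(c (j + 1))\<^sup>2 > 0" by (simp add: c_def del: binomial_Suc_Suc add_Suc_right)
  have eq: "c j * c (j + 2) * A = (c (j + 1))\<^sup>2 * B"
    using binomial_pair_eq[of a j] by (simp only: c_def A_def B_def)
  have "c j * h j * (c (j + 2) * h (j + 2)) \<le> (c (j + 1) * h (j + 1))\<^sup>2 \<longleftrightarrow>
      A * (c j * h j * (c (j + 2) * h (j + 2))) \<le> A * (c (j + 1) * h (j + 1))\<^sup>2"
    using A by (simp only: mult_le_cancel_left_pos)
  also have "A * (c j * h j * (c (j + 2) * h (j + 2))) =
      (c (j + 1))\<^sup>2 * (B * (h j * h (j + 2)))"
    using eq by algebra
  also have "A * (c (j + 1) * h (j + 1))\<^sup>2 = (c (j + 1))\<^sup>2 * (A * (h (j + 1))\<^sup>2)"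
    by algebra
  also have "(c (j + 1))\<^sup>2 * (B * (h j * h (j + 2))) \<le> (c (j + 1))\<^sup>2 * (A * (h (j + 1))\<^sup>2) \<longleftrightarrow>
      B * (h j * h (j + 2)) \<le> A * (h (j + 1))\<^sup>2"
    using c by (simp only: mult_le_cancel_left_pos)
  finally show ?thesis by (simp only: f A_def B_def)
qed

lemma riff_shuffle_pmf_half_log_concave:
  assumes "m \<ge> 1"
  shows "log_concave n (riff_shuffle_pmf m (1 / 2))"
  unfolding log_concave_def
proof (intro allI impI)
  fix k assume "1 \<le> k \<and> k < n"
  then obtain j where k: "k = j + 1" by (metis le_add_diff_inverse2)
  obtain a where m: "m = a + 1" using assms by (metis le_add_diff_inverse2)
  \<comment> \<open>The right side exceeds the left by exactly \<open>a\<close>.\<close>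
  have "real (j + 1) * real (a + j + 2) \<le> real (a + j + 1) * real (j + 2)"
    by (simp add: algebra_simps)
  then have "real (j + 1) * real (a + j + 2) * (riff_weight m (1/2) (j + 1))\<^sup>2
      \<le> real (a + j + 1) * real (j + 2) * (riff_weight m (1/2) (j + 1))\<^sup>2"
    by (rule mult_right_mono) simp
  moreover have "riff_weight m (1/2) j * riff_weight m (1/2) (j + 2) = (riff_weight m (1/2) (j + 1))\<^sup>2"
    by (simp add: riff_weight_mult_eq del: add_2_eq_Suc')
  ultimately have "riff_shuffle_pmf m (1/2) j * riff_shuffle_pmf m (1/2) (j + 2)
       \<le> (riff_shuffle_pmf m (1/2) (j + 1))\<^sup>2"
    unfolding m riff_shuffle_pmf_mult_le_iff by (simp only:)
  then show "riff_shuffle_pmf m (1/2) (k - 1) * riff_shuffle_pmf m (1/2) (k + 1)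
       \<le> (riff_shuffle_pmf m (1/2) k)\<^sup>2"
    by (simp add: k)
qed

text \<open>For \<open>m = n + 3\<close>, log-concavity fails at the last interior index
  \<open>n + 1 = m - 2\<close>. Assumption \<open>n\<close> says that the relative excess of the
  weights is larger than \<open>1 / (2 * (n + 1))\<close>.\<close>

lemma riff_shuffle_pmf_not_log_concave:
  fixes p :: real and n :: nat
  assumes p: "0 < p" "p < 1"
    and n: "(p\<^sup>2 + (1 - p)\<^sup>2)\<^sup>2 < 2 * real (n + 1) * (p * (1 - p) * (2 * p - 1)\<^sup>2)"
  shows "\<not> log_concave (n + 2) (riff_shuffle_pmf (n + 3) p)"
proof
  assume lc: "log_concave (n + 2) (riff_shuffle_pmf (n + 3) p)"
  define h where "h = riff_weight (n + 3) p"
  \<comment> \<open>The common power of \<open>p * (1 - p)\<close> in the squared weight and in the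
    excess; cancelling it leaves a comparison of constants up to the factor
    \<open>2 * (n + 1)\<close>.\<close>
  define P where "P = ((p * (1 - p)) ^ (n + 1))\<^sup>2"
  have P: "P > 0" using p by (simp add: P_def)
  have "riff_shuffle_pmf ((n + 2) + 1) p n * riff_shuffle_pmf ((n + 2) + 1) p (n + 2)
      \<le> (riff_shuffle_pmf ((n + 2) + 1) p (n + 1))\<^sup>2"
    using lc[unfolded log_concave_def, rule_format, of "n + 1"] by (simp add: numeral_3_eq_3)
  then have "real (n + 1) * real (n + 2 + n + 2) * (h n * h (n + 2))
      \<le> real (n + 2 + n + 1) * real (n + 2) * (h (n + 1))\<^sup>2"
    unfolding riff_shuffle_pmf_mult_le_iff by (simp add: h_def numeral_3_eq_3)
  \<comment> \<open>At this index \<open>n + 2 + n + 2 = 2 * (n + 2)\<close>, so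
    \<open>n + 2\<close> cancels.\<close>
  then have "real (n + 2) * (2 * real (n + 1) * (h n * h (n + 2)))
      \<le> real (n + 2) * ((2 * real (n + 1) + 1) * (h (n + 1))\<^sup>2)"
    by (simp add: algebra_simps)
  then have "2 * real (n + 1) * (h n * h (n + 2)) \<le> (2 * real (n + 1) + 1) * (h (n + 1))\<^sup>2"
    by (rule mult_left_le_imp_le) simp
  moreover have "h n * h (n + 2) = (h (n + 1))\<^sup>2 + P * (p * (1 - p) * (2 * p - 1)\<^sup>2)"
  proof -
    have "(p * (1 - p)) ^ (n + 3 + n) = P * (p * (1 - p))"
      unfolding P_def power_mult[symmetric] power_Suc2[symmetric]
      by (rule arg_cong[where f = "(^) _"]) simp
    then show ?thesis
      unfolding h_def riff_weight_mult_eq by simp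
  qed
  moreover have "(h (n + 1))\<^sup>2 = P * (p\<^sup>2 + (1 - p)\<^sup>2)\<^sup>2"
  proof -
    have "p ^ (n + 3) = p ^ (n + 1) * p\<^sup>2" "(1 - p) ^ (n + 3) = (1 - p) ^ (n + 1) * (1 - p)\<^sup>2"
      by (simp_all add: power_add[symmetric] numeral_3_eq_3)
    then have "h (n + 1) = (p * (1 - p)) ^ (n + 1) * (p\<^sup>2 + (1 - p)\<^sup>2)"
      unfolding h_def riff_weight_def power_mult_distrib by (simp only: distrib_left mult_ac)
    then show ?thesis by (simp only: P_def power_mult_distrib)
  qed
  \<comment> \<open>Subtract \<open>2 * (n + 1)\<close> copies of \<open>(h (n + 1))\<^sup>2\<close>
    from both sides.\<close>
  ultimately have "P * (2 * real (n + 1) * (p * (1 - p) * (2 * p - 1)\<^sup>2)) \<le> P * (p\<^sup>2 + (1 - p)\<^sup>2)\<^sup>2"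
    by (simp only: distrib_left distrib_right mult_1 mult.left_commute mult.commute)
  then show False using n P by simp
qed

theorem proposition1:
  fixes p :: real
  assumes "0 < p" and "p < 1"
  shows "(p = 1 / 2 \<longrightarrow>
            (\<forall>m::nat. m \<ge> 1 \<longrightarrow> log_concave (m - 1) (riff_shuffle_pmf m p))) \<and>
         (p \<noteq> 1 / 2 \<longrightarrow>
            (\<exists>m0::nat. m0 \<ge> 1 \<and>
              (\<forall>m::nat. m \<ge> m0 \<longrightarrow> \<not> log_concave (m - 1) (riff_shuffle_pmf m p))))"
proof (intro conjI impI allI)
  fix m :: nat assume "p = 1 / 2" "m \<ge> 1"
  then show "log_concave (m - 1) (riff_shuffle_pmf m p)"
    by (simp only: riff_shuffle_pmf_half_log_concave)
next
  assume "p \<noteq> 1 / 2"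
  define d where "d = p * (1 - p) * (2 * p - 1)\<^sup>2"
  have d: "d > 0" using assms \<open>p \<noteq> 1 / 2\<close> by (simp add: d_def)
  then obtain N :: nat where N: "(p\<^sup>2 + (1 - p)\<^sup>2)\<^sup>2 < real N * d"
    using reals_Archimedean3 by blast
  \<comment> \<open>The shift by 3 yields \<open>m = n + 3\<close> with \<open>n \<ge> N\<close>,
    whence \<open>2 * (n + 1) \<ge> N\<close>.\<close>
  have "\<not> log_concave (m - 1) (riff_shuffle_pmf m p)" if m: "m \<ge> N + 3" for m
  proof -
    obtain n where n: "m = n + 3" "n \<ge> N"
      using m by (metis add_le_imp_le_right le_add_diff_inverse2 le_add2 le_trans)
    have "real N * d \<le> 2 * real (n + 1) * d"
      using n d by (intro mult_right_mono) auto
    then have "(p\<^sup>2 + (1 - p)\<^sup>2)\<^sup>2 < 2 * real (n + 1) * d" using N by linarith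
    then have "\<not> log_concave (n + 2) (riff_shuffle_pmf (n + 3) p)"
      unfolding d_def by (rule riff_shuffle_pmf_not_log_concave[OF assms])
    then show ?thesis by (simp add: n numeral_3_eq_3)
  qed
  then show "\<exists>m0::nat. m0 \<ge> 1 \<and> (\<forall>m::nat. m \<ge> m0 \<longrightarrow> \<not> log_concave (m - 1) (riff_shuffle_pmf m p))"
    by (intro exI[of _ "N + 3"]) simp
qed

end
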